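(* For $n\ge1$ let $S_n$ be the star-shaped graph with $n+1$ vertices $v_0,v_1,\dots,v_n$ and $n$ edges $[v_0,v_1],\dots,[v_0,v_n]$, and let $I_n=\{1,\dots,n\}$. Write $z_i$ for the variable $z_{v_i}$, and $\vec z^{\,S}=\prod_{i\in S}z_i$ for $S\subset I_n$. Then $$T[Q_{S_n}]=\frac1{4^n}\sum_{S\subset I_n}\vec z^{\,S}+\frac1{4^n}\sum_{S\subset I_n}(n-|S|)\,z_0\,\vec z^{\,S},$$ $$P(S_n)=\frac{n+2}{2^{n+1}},$$ and $h(S_n)\sim\log\left(\frac12\right)$ as $n\to\infty$.
   Context: Let $\Gamma$ be a finite graph without loops or multiple edges, with vertex set $V(\Gamma)$, edge set $E(\Gamma)$, and $N_\Gamma=|E(\Gamma)|$. Let $I_\Gamma\subset V(\Gamma)\times E(\Gamma)$ be the set of pairs $(v,e)$ with $v$ an endpoint of $e$ (so $|I_\Gamma|=2N_\Gamma$). An orientation prescription is a function $\omega:I_\Gamma\to\{\pm1\}$; it orients each edge of the barycentric subdivision of $\Gamma$ (whose edges join a vertex $v$ to the midpoint $b_e$ of an incident edge $e$): the edge is oriented $b_e\to v$ if $\omega(v,e)=1$, and $v\to b_e$ if $\omega(v,e)=-1$. The prescription $\omega$ is a combinatorial flow if every vertex $v\in V(\Gamma)$ has at most one outgoing edge and every midpoint $b_e$ has at most one incoming edge; equivalently, for each $v$ there is at most one $e$ with $\omega(v,e)=-1$, and for each $e$ there is at most one $v$ with $\omega(v,e)=-1$. Let $P(\Gamma)$ be the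 probability that a uniformly random orientation prescription is a combinatorial flow, i.e. $P(\Gamma)=4^{-N_\Gamma}\cdot\#\{\text{combinatorial flows on }\Gamma\}$. Define $h(\Gamma)=\frac{\log P(\Gamma)}{N_\Gamma}$ if $E(\Gamma)\ne\emptyset$ and $h(\Gamma)=0$ otherwise. With formal variables $(z_v)_{v\in V(\Gamma)}$, define $Q_\Gamma=\prod_{e\in E(\Gamma)}Q_e$, where $Q_e=\frac14(1+z_u+z_v)$ for an edge $e$ with endpoints $u,v$. For a polynomial $\sum_\alpha p_\alpha\prod_v z_v^{\alpha_v}$, its truncation $T[\cdot]$ is the polynomial obtained by keeping only the terms with $\alpha_v\le1$ for all $v$. The notation $a_n\sim a$ for a nonzero constant $a$ means $a_n/a\to1$, i.e. $a_n\to a$. *)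

theory Defs
  imports
    "HOL-Probability.Probability_Mass_Function"
    "HOL-Library.Poly_Mapping"
    "HOL-Library.Landau_Symbols"
begin

record 'v graph =
  verts :: "'v set"
  edges :: "'v set set"

text \<open>Having no loops and no multiple edges, a graph is given by edges that are
  two-element sets of vertices.\<close>

definition simple_graph :: "'v graph \<Rightarrow> bool" where
  "simple_graph G \<longleftrightarrow>
     finite (verts G) \<and> (\<forall>e\<in>edges G. e \<subseteq> verts G \<and> card e = 2)"

definition num_edges :: "'v graph \<Rightarrow> nat" where
  "num_edges G = card (edges G)"

definition incidences :: "'v graph \<Rightarrow> ('v \<times> 'v set) set" where
  "incidences G = {(v, e). v \<in> verts G \<and> e \<in> edges G \<and> v \<in> e}"

definition orientations :: "'v graph \<Rightarrow> ('v \<times> 'v set \<Rightarrow> int) set" where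
  "orientations G = incidences G \<rightarrow>\<^sub>E {-1, 1}"

datatype 'v bary = Orig 'v | Mid "'v set"

text \<open>An arc \<open>(x, y)\<close> of the barycentric subdivision is oriented from \<open>x\<close> to \<open>y\<close>.\<close>

definition bary_arc :: "('v \<times> 'v set \<Rightarrow> int) \<Rightarrow> 'v \<times> 'v set \<Rightarrow> 'v bary \<times> 'v bary" where
  "bary_arc \<omega> = (\<lambda>(v, e). if \<omega> (v, e) = 1 then (Mid e, Orig v) else (Orig v, Mid e))"

definition bary_arcs :: "'v graph \<Rightarrow> ('v \<times> 'v set \<Rightarrow> int) \<Rightarrow> ('v bary \<times> 'v bary) set" where
  "bary_arcs G \<omega> = bary_arc \<omega> ` incidences G"

definition comb_flow :: "'v graph \<Rightarrow> ('v \<times> 'v set \<Rightarrow> int) \<Rightarrow> bool" where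
  "comb_flow G \<omega> \<longleftrightarrow>
     (\<forall>v\<in>verts G. \<exists>\<^sub>\<le>\<^sub>1 a. a \<in> bary_arcs G \<omega> \<and> fst a = Orig v) \<and>
     (\<forall>e\<in>edges G. \<exists>\<^sub>\<le>\<^sub>1 a. a \<in> bary_arcs G \<omega> \<and> snd a = Mid e)"

definition flow_prob :: "'v graph \<Rightarrow> real" where
  "flow_prob G = measure_pmf.prob (pmf_of_set (orientations G)) {\<omega>. comb_flow G \<omega>}"

definition flow_entropy :: "'v graph \<Rightarrow> real" where
  "flow_entropy G =
     (if edges G \<noteq> {} then ln (flow_prob G) / real (num_edges G) else 0)"

lemma Uniq_image:
  assumes "inj f"
  shows "(\<exists>\<^sub>\<le>\<^sub>1 a. \<exists>x. a = f x \<and> P x) \<longleftrightarrow> (\<exists>\<^sub>\<le>\<^sub>1 x. P x)"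
  unfolding Uniq_def using injD[OF assms] by metis

lemma comb_flow_iff:
  assumes "\<omega> \<in> orientations G"
  shows "comb_flow G \<omega> \<longleftrightarrow>
     (\<forall>v\<in>verts G. \<exists>\<^sub>\<le>\<^sub>1 e. (v, e) \<in> incidences G \<and> \<omega> (v, e) = -1) \<and>
     (\<forall>e\<in>edges G. \<exists>\<^sub>\<le>\<^sub>1 v. (v, e) \<in> incidences G \<and> \<omega> (v, e) = -1)"
proof -
  have pm: "\<omega> p = 1 \<or> \<omega> p = -1" if "p \<in> incidences G" for p
    using assms that by (auto simp: orientations_def PiE_iff)
  have out: "a \<in> bary_arcs G \<omega> \<and> fst a = Orig v \<longleftrightarrow>
      (\<exists>e. a = (Orig v, Mid e) \<and> (v, e) \<in> incidences G \<and> \<omega> (v, e) = -1)" (is "?L \<longleftrightarrow> ?R") for a v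
  proof
    assume ?L
    then obtain p where p: "p \<in> incidences G" "a = bary_arc \<omega> p" "fst a = Orig v"
      unfolding bary_arcs_def by blast
    obtain w d where wd: "p = (w, d)"
      by (cases p)
    have "\<omega> (w, d) \<noteq> 1" "a = (Orig w, Mid d)" "w = v"
      using p(2,3) by (auto simp: wd bary_arc_def split: if_splits)
    then show ?R
      using pm[OF p(1)] p(1) wd by blast
  next
    assume ?R
    then obtain e where e: "a = (Orig v, Mid e)" "(v, e) \<in> incidences G" "\<omega> (v, e) = -1"
      by blast
    then have "a = bary_arc \<omega> (v, e)"
      by (simp add: bary_arc_def)
    then show ?L
      using e(1,2) unfolding bary_arcs_def by (metis image_eqI prod.sel)
  qed
  have inc: "a \<in> bary_arcs G \<omega> \<and> snd a = Mid e \<longleftrightarrow>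
      (\<exists>v. a = (Orig v, Mid e) \<and> (v, e) \<in> incidences G \<and> \<omega> (v, e) = -1)" (is "?L \<longleftrightarrow> ?R") for a e
  proof
    assume ?L
    then obtain p where p: "p \<in> incidences G" "a = bary_arc \<omega> p" "snd a = Mid e"
      unfolding bary_arcs_def by blast
    obtain w d where wd: "p = (w, d)"
      by (cases p)
    have "\<omega> (w, d) \<noteq> 1" "a = (Orig w, Mid d)" "d = e"
      using p(2,3) by (auto simp: wd bary_arc_def split: if_splits)
    then show ?R
      using pm[OF p(1)] p(1) wd by blast
  next
    assume ?R
    then obtain v where v: "a = (Orig v, Mid e)" "(v, e) \<in> incidences G" "\<omega> (v, e) = -1"
      by blast
    then have "a = bary_arc \<omega> (v, e)"
      by (simp add: bary_arc_def)
    then show ?L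
      using v(1,2) unfolding bary_arcs_def by (metis image_eqI prod.sel)
  qed
  have "(\<exists>\<^sub>\<le>\<^sub>1 a. a \<in> bary_arcs G \<omega> \<and> fst a = Orig v) \<longleftrightarrow>
      (\<exists>\<^sub>\<le>\<^sub>1 e. (v, e) \<in> incidences G \<and> \<omega> (v, e) = -1)" for v
    unfolding out by (rule Uniq_image) (auto intro: injI)
  moreover have "(\<exists>\<^sub>\<le>\<^sub>1 a. a \<in> bary_arcs G \<omega> \<and> snd a = Mid e) \<longleftrightarrow>
      (\<exists>\<^sub>\<le>\<^sub>1 v. (v, e) \<in> incidences G \<and> \<omega> (v, e) = -1)" for e
    unfolding inc by (rule Uniq_image) (auto intro: injI)
  ultimately show ?thesis
    by (simp only: comb_flow_def)
qed

lemma card_incidences: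
  assumes "simple_graph G"
  shows "finite (incidences G)" "card (incidences G) = 2 * num_edges G"
proof -
  have fin: "finite (edges G)"
    by (rule finite_subset[of _ "Pow (verts G)"]) (use assms in \<open>auto simp: simple_graph_def\<close>)
  have fin_e: "finite e" if "e \<in> edges G" for e
    using assms that by (metis card.infinite simple_graph_def zero_neq_numeral)
  have eq: "incidences G = prod.swap ` Sigma (edges G) (\<lambda>e. e)"
    using assms by (fastforce simp: incidences_def simple_graph_def image_iff)
  show "finite (incidences G)"
    unfolding eq using fin fin_e by auto
  have "card (incidences G) = card (Sigma (edges G) (\<lambda>e. e))"
    unfolding eq by (rule card_image) (auto intro: inj_onI)
  also have "\<dots> = (\<Sum>e\<in>edges G. card e)"
    using fin fin_e by simp
  also have "\<dots> = (\<Sum>e\<in>edges G. 2)"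
    using assms by (intro sum.cong) (auto simp: simple_graph_def)
  finally show "card (incidences G) = 2 * num_edges G"
    by (simp add: num_edges_def)
qed

lemma flow_prob_eq:
  assumes "simple_graph G"
  shows "flow_prob G = real (card {\<omega> \<in> orientations G. comb_flow G \<omega>}) / 4 ^ num_edges G"
proof -
  note inc = card_incidences[OF assms]
  have fin: "finite (orientations G)"
    unfolding orientations_def using inc(1) by (intro finite_PiE) auto
  have card: "card (orientations G) = 4 ^ num_edges G"
  proof -
    have "card (orientations G) = card {-1, 1 :: int} ^ card (incidences G)"
      unfolding orientations_def using inc(1) by (simp add: card_PiE)
    also have "card {-1, 1 :: int} = 2"
      by simp
    finally show ?thesis
      by (simp add: inc(2) power_mult)
  qed
  have ne: "orientations G \<noteq> {}"
    using card by (metis card.empty power_not_zero zero_neq_numeral)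
  have "orientations G \<inter> {\<omega>. comb_flow G \<omega>} = {\<omega> \<in> orientations G. comb_flow G \<omega>}"
    by auto
  then show ?thesis
    using measure_pmf_of_set[OF ne fin] card by (simp add: flow_prob_def)
qed

text \<open>Real polynomials in variables indexed by \<open>'v\<close>: finitely supported functions from
  exponent vectors \<open>\<alpha> :: 'v \<Rightarrow>\<^sub>0 nat\<close> to coefficients, multiplied by convolution.\<close>

type_synonym 'v mpoly = "('v \<Rightarrow>\<^sub>0 nat) \<Rightarrow>\<^sub>0 real"

definition Const :: "real \<Rightarrow> 'v mpoly" where
  "Const c = Poly_Mapping.single 0 c"

definition Var :: "'v \<Rightarrow> 'v mpoly" where
  "Var v = Poly_Mapping.single (Poly_Mapping.single v 1) 1"

definition edge_poly :: "'v set \<Rightarrow> 'v mpoly" where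
  "edge_poly e = Const (1/4) * (1 + (\<Sum>v\<in>e. Var v))"

definition graph_poly :: "'v graph \<Rightarrow> 'v mpoly" where
  "graph_poly G = (\<Prod>e\<in>edges G. edge_poly e)"

definition trunc :: "'v mpoly \<Rightarrow> 'v mpoly" where
  "trunc p = (\<Sum>\<alpha> | \<alpha> \<in> Poly_Mapping.keys p \<and> (\<forall>v. Poly_Mapping.lookup \<alpha> v \<le> 1).
                Poly_Mapping.single \<alpha> (Poly_Mapping.lookup p \<alpha>))"

text \<open>The vertex \<open>v\<^sub>i\<close> of the star is the natural number \<open>i\<close>.\<close>

definition star :: "nat \<Rightarrow> nat graph" where
  "star n = \<lparr>verts = {0..n}, edges = (\<lambda>i. {0, i}) ` {1..n}\<rparr>"

lemma simple_graph_star: "simple_graph (star n)"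
  by (auto simp: simple_graph_def star_def)

lemma num_edges_star: "num_edges (star n) = n"
proof -
  have "inj_on (\<lambda>i. {0, i}) {1..n}"
    by (auto simp: inj_on_def doubleton_eq_iff)
  then show ?thesis
    by (simp add: num_edges_def star_def card_image)
qed

end

theory Submission
  imports Defs "HOL-Real_Asymp.Real_Asymp"
begin

text \<open>Each edge factor of the star is (z_i + (1 + z_0))/4. Expanding the product by the set S
  of indices where z_i is chosen gives 4^(-n) times the sum of (1 + z_0)^(n-|S|) z^S
  (\<open>graph_poly_star\<close>). Since 0 is not in S, truncation acts on the power of 1 + z_0
  alone and leaves its part of degree at most one, 1 + (n-|S|) z_0
  (\<open>trunc_one_plus_Var_power\<close>).

  The probability comes from a direct count (\<open>card_flows_star\<close>). The leaves directed
  towards their midpoints form an arbitrary set T, and the centre has either no outgoing edge or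
  one, towards a midpoint whose leaf is outside T. This gives the sum over T of 1 + (n-|T|), which
  is 2^n + n 2^(n-1); dividing by 4^n yields P. In ln P / n only the factor 2^(n+1) matters in the
  limit.\<close>

section \<open>Truncation of polynomials\<close>

lemma lookup_trunc:
  "Poly_Mapping.lookup (trunc p) \<alpha> =
     (if \<forall>v. Poly_Mapping.lookup \<alpha> v \<le> 1 then Poly_Mapping.lookup p \<alpha> else 0)"
proof -
  let ?K = "{\<alpha> \<in> Poly_Mapping.keys p. \<forall>v. Poly_Mapping.lookup \<alpha> v \<le> 1}"
  have "Poly_Mapping.lookup (trunc p) \<alpha> =
      (\<Sum>\<beta>\<in>?K. if \<beta> = \<alpha> then Poly_Mapping.lookup p \<beta> else 0)"
    by (simp add: trunc_def lookup_sum lookup_single when_def)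
  also have "\<dots> = (if \<alpha> \<in> ?K then Poly_Mapping.lookup p \<alpha> else 0)"
    by simp
  finally show ?thesis
    by (simp add: in_keys_iff)
qed

lemma trunc_add: "trunc (p + q) = trunc p + trunc q"
  by (rule poly_mapping_eqI) (simp add: lookup_trunc lookup_add)

lemma trunc_sum: "trunc (\<Sum>x\<in>A. f x) = (\<Sum>x\<in>A. trunc (f x))"
  by (induction A rule: infinite_finite_induct) (simp_all add: trunc_add, simp_all add: trunc_def)

lemma trunc_single:
  "trunc (Poly_Mapping.single \<alpha> c) =
     (if \<forall>v. Poly_Mapping.lookup \<alpha> v \<le> 1 then Poly_Mapping.single \<alpha> c else 0)"
  by (rule poly_mapping_eqI) (auto simp: lookup_trunc lookup_single when_def)

lemma Const_mult: "Const (a * b) = Const a * Const b"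
  by (simp add: Const_def mult_single)

lemma Const_1 [simp]: "Const 1 = 1"
  by (simp add: Const_def)

lemma Const_power: "Const (a ^ n) = Const a ^ n"
  by (induction n) (simp_all add: Const_mult)

lemma of_nat_eq_Const: "of_nat n = Const (real n)"
  by (induction n) (simp_all add: Const_def single_add)

lemma trunc_Const_mult: "trunc (Const c * p) = Const c * trunc p"
proof -
  have "Poly_Mapping.lookup (Const c * q) \<alpha> = c * Poly_Mapping.lookup q \<alpha>" for q :: "'a mpoly" and \<alpha>
    by (simp add: Const_def map.rep_eq when_def flip: mult_map_scale_conv_mult)
  then show ?thesis
    by (intro poly_mapping_eqI) (simp add: lookup_trunc)
qed

lemma Var_power: "Var v ^ k = Poly_Mapping.single (Poly_Mapping.single v k) 1"
  by (induction k) (simp_all add: Var_def mult_single flip: single_add)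

lemma prod_Var:
  "finite S \<Longrightarrow> (\<Prod>i\<in>S. Var i) = Poly_Mapping.single (\<Sum>i\<in>S. Poly_Mapping.single i 1) 1"
  by (induction rule: finite_induct) (simp_all add: Var_def mult_single)

text \<open>The variables indexed by \<open>S\<close> have exponent 1 and \<open>v\<close> lies
  outside \<open>S\<close>, so \<open>k\<close> alone decides whether the monomial survives.\<close>

lemma trunc_monomial:
  assumes "finite S" "v \<notin> S"
  shows "trunc (Var v ^ k * (\<Prod>i\<in>S. Var i)) =
    (if k \<le> 1 then Var v ^ k * (\<Prod>i\<in>S. Var i) else 0)"
proof -
  let ?\<alpha> = "Poly_Mapping.single v k + (\<Sum>i\<in>S. Poly_Mapping.single i 1)"
  have "Poly_Mapping.lookup ?\<alpha> w = (if w = v then k else if w \<in> S then 1 else 0)" for w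
    using assms by (auto simp: lookup_add lookup_sum lookup_single when_def)
  then have "(\<forall>w. Poly_Mapping.lookup ?\<alpha> w \<le> 1) \<longleftrightarrow> k \<le> 1"
    by auto
  then show ?thesis
    using assms by (simp add: Var_power prod_Var mult_single trunc_single)
qed

lemma trunc_one_plus_Var_power:
  assumes "finite S" "v \<notin> S"
  shows "trunc ((1 + Var v) ^ m * (\<Prod>i\<in>S. Var i)) =
    (\<Prod>i\<in>S. Var i) + Const (real m) * Var v * (\<Prod>i\<in>S. Var i)"
proof -
  let ?t = "\<lambda>k. if k \<le> 1 then Const (real (m choose k)) * (Var v ^ k * (\<Prod>i\<in>S. Var i)) else 0"
  have "(1 + Var v) ^ m * (\<Prod>i\<in>S. Var i) =
      (\<Sum>k\<le>m. Const (real (m choose k)) * (Var v ^ k * (\<Prod>i\<in>S. Var i)))"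
    by (simp add: add.commute[of 1] binomial_ring of_nat_eq_Const sum_distrib_right mult.assoc)
  then have "trunc ((1 + Var v) ^ m * (\<Prod>i\<in>S. Var i)) = (\<Sum>k\<le>m. ?t k)"
    using assms by (simp add: trunc_sum trunc_Const_mult trunc_monomial if_distrib cong: if_cong)
  \<comment> \<open>For m = 0 the index 1 is not in the original range, but its term vanishes
    because 0 choose 1 is 0; hence the case split.\<close>
  also have "\<dots> = (\<Sum>k\<in>{0, 1}. ?t k)"
    by (cases m; intro sum.mono_neutral_cong) (auto simp: Const_def)
  finally show ?thesis
    by (simp add: mult.assoc)
qed

section \<open>The polynomial of the star\<close>

lemma inj_on_star_edge: "inj_on (\<lambda>i. {0, i}) {1..n::nat}"
  by (auto simp: inj_on_def doubleton_eq_iff)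

text \<open>Keeping 1 + z_0 together as one summand makes every term squarefree in the leaf
  variables, so that only powers of z_0 remain to be truncated.\<close>

lemma graph_poly_star:
  "graph_poly (star n) = Const (1 / 4 ^ n) *
     (\<Sum>S\<in>Pow {1..n}. (1 + Var 0) ^ (n - card S) * (\<Prod>i\<in>S. Var i))"
proof -
  have "graph_poly (star n) = (\<Prod>i\<in>{1..n}. edge_poly {0, i})"
    using inj_on_star_edge by (simp add: graph_poly_def star_def prod.reindex)
  also have "\<dots> = (\<Prod>i\<in>{1..n}. Const (1/4) * (Var i + (1 + Var 0)))"
    by (rule prod.cong) (auto simp: edge_poly_def algebra_simps)
  also have "\<dots> = Const (1 / 4 ^ n) *
      (\<Sum>S\<in>Pow {1..n}. (\<Prod>i\<in>S. Var i) * (\<Prod>i\<in>{1..n} - S. 1 + Var 0))"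
    by (simp add: prod.distrib prod_add power_one_over flip: Const_power)
  also have "(\<Sum>S\<in>Pow {1..n}. (\<Prod>i\<in>S. Var i) * (\<Prod>i\<in>{1..n} - S. 1 + Var 0)) =
      (\<Sum>S\<in>Pow {1..n}. (1 + Var 0) ^ (n - card S) * (\<Prod>i\<in>S. Var i :: nat mpoly))"
    by (rule sum.cong) (auto simp: card_Diff_subset finite_subset mult.commute)
  finally show ?thesis .
qed

lemma trunc_graph_poly_star:
  "trunc (graph_poly (star n)) =
     Const (1 / 4 ^ n) * (\<Sum>S\<in>Pow {1..n}. \<Prod>i\<in>S. Var i)
   + Const (1 / 4 ^ n) *
       (\<Sum>S\<in>Pow {1..n}. Const (real n - real (card S)) * Var 0 * (\<Prod>i\<in>S. Var i))"
proof -
  have "trunc ((1 + Var 0) ^ (n - card S) * (\<Prod>i\<in>S. Var i)) =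
      (\<Prod>i\<in>S. Var i) + Const (real n - real (card S)) * Var 0 * (\<Prod>i\<in>S. Var i)"
    if "S \<in> Pow {1..n}" for S
  proof -
    \<comment> \<open>The bound on \<open>card S\<close> turns the natural-number exponent
      \<open>n - card S\<close> into the real difference in the coefficient.\<close>
    have "finite S" "0 \<notin> S" "card S \<le> n"
      using that card_mono[of "{1..n}" S] by (auto intro: finite_subset)
    then show ?thesis
      by (simp add: trunc_one_plus_Var_power of_nat_diff)
  qed
  then show ?thesis
    by (simp add: graph_poly_star trunc_Const_mult trunc_sum sum.distrib distrib_left)
qed

section \<open>Counting flows on the star\<close>

text \<open>Complementation permutes the subsets of \<open>I\<close>, and a subset and its
  complement have \<open>card I\<close> elements together. Doubling avoids a division in the
  naturals.\<close>

lemma sum_card_Diff_Pow: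
  assumes "finite I"
  shows "2 * (\<Sum>T\<in>Pow I. card (I - T)) = card I * 2 ^ card I"
proof -
  have "(\<Sum>T\<in>Pow I. card (I - T)) = (\<Sum>T\<in>Pow I. card T)"
    by (rule sum.reindex_bij_witness[of _ "\<lambda>T. I - T" "\<lambda>T. I - T"]) auto
  then have "2 * (\<Sum>T\<in>Pow I. card (I - T)) = (\<Sum>T\<in>Pow I. card (I - T) + card T)"
    by (simp add: sum.distrib)
  also have "\<dots> = (\<Sum>T\<in>Pow I. card I)"
    using assms by (intro sum.cong) (auto simp: card_Diff_subset finite_subset card_mono)
  finally show ?thesis
    using assms by (simp add: card_Pow)
qed

lemma incidences_star:
  "incidences (star n) = (\<lambda>i. (0, {0, i})) ` {1..n} \<union> (\<lambda>i. (i, {0, i})) ` {1..n}"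
  by (auto simp: incidences_def star_def)

lemma Uniq_doubleton:
  "x \<noteq> y \<Longrightarrow> (\<exists>\<^sub>\<le>\<^sub>1 v. (v = x \<or> v = y) \<and> P v) \<longleftrightarrow> (P x \<longrightarrow> \<not> P y)"
  unfolding Uniq_def by blast

text \<open>A leaf has a single incident edge, so only the centre and the midpoints constrain a
  prescription.\<close>

lemma comb_flow_star_iff:
  assumes "\<omega> \<in> orientations (star n)"
  shows "comb_flow (star n) \<omega> \<longleftrightarrow>
     (\<exists>\<^sub>\<le>\<^sub>1 i. i \<in> {1..n} \<and> \<omega> (0, {0, i}) = -1) \<and>
     (\<forall>i\<in>{1..n}. \<omega> (0, {0, i}) = -1 \<longrightarrow> \<omega> (i, {0, i}) \<noteq> -1)"
proof -
  have v: "verts (star n) = insert 0 {1..n}" and e: "edges (star n) = (\<lambda>i. {0, i}) ` {1..n}"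
    by (auto simp: star_def)
  \<comment> \<open>Injectivity lets uniqueness of an edge at the centre be stated as uniqueness of
    its leaf index.\<close>
  have inj: "inj (\<lambda>i::nat. {0, i})"
    by (auto simp: inj_def doubleton_eq_iff)
  have "(0, e) \<in> incidences (star n) \<and> \<omega> (0, e) = -1 \<longleftrightarrow>
      (\<exists>i. e = {0, i} \<and> i \<in> {1..n} \<and> \<omega> (0, {0, i}) = -1)" for e
    by (auto simp: incidences_star)
  then have zero: "(\<exists>\<^sub>\<le>\<^sub>1 e. (0, e) \<in> incidences (star n) \<and> \<omega> (0, e) = -1) \<longleftrightarrow>
      (\<exists>\<^sub>\<le>\<^sub>1 i. i \<in> {1..n} \<and> \<omega> (0, {0, i}) = -1)"
    by (simp only: Uniq_image[OF inj])
  have leaf: "\<exists>\<^sub>\<le>\<^sub>1 e. (i, e) \<in> incidences (star n) \<and> \<omega> (i, e) = -1" if "i \<in> {1..n}" for i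
  proof -
    have "e = {0, i}" if "(i, e) \<in> incidences (star n)" for e
      using that \<open>i \<in> {1..n}\<close> by (auto simp: incidences_star)
    then show ?thesis
      unfolding Uniq_def by blast
  qed
  have mid: "(\<exists>\<^sub>\<le>\<^sub>1 v. (v, {0, i}) \<in> incidences (star n) \<and> \<omega> (v, {0, i}) = -1) \<longleftrightarrow>
      (\<omega> (0, {0, i}) = -1 \<longrightarrow> \<omega> (i, {0, i}) \<noteq> -1)" if "i \<in> {1..n}" for i
  proof -
    have "0 \<noteq> i" "{0, i} \<in> edges (star n)" "0 \<in> verts (star n)" "i \<in> verts (star n)"
      using that unfolding v e by auto
    then have "(v, {0, i}) \<in> incidences (star n) \<longleftrightarrow> v = 0 \<or> v = i" for v
      unfolding incidences_def by blast
    then show ?thesis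
      using Uniq_doubleton[OF \<open>0 \<noteq> i\<close>, of "\<lambda>v. \<omega> (v, {0, i}) = -1"] by (simp only:)
  qed
  have "(\<forall>v\<in>verts (star n). \<exists>\<^sub>\<le>\<^sub>1 e. (v, e) \<in> incidences (star n) \<and> \<omega> (v, e) = -1) \<longleftrightarrow>
      (\<exists>\<^sub>\<le>\<^sub>1 i. i \<in> {1..n} \<and> \<omega> (0, {0, i}) = -1)"
    unfolding v zero[symmetric] using leaf by blast
  moreover have "(\<forall>e\<in>edges (star n). \<exists>\<^sub>\<le>\<^sub>1 v. (v, e) \<in> incidences (star n) \<and> \<omega> (v, e) = -1) \<longleftrightarrow>
      (\<forall>i\<in>{1..n}. \<omega> (0, {0, i}) = -1 \<longrightarrow> \<omega> (i, {0, i}) \<noteq> -1)"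
    unfolding e ball_simps by (rule ball_cong[OF refl mid])
  ultimately show ?thesis
    by (simp only: comb_flow_iff[OF assms])
qed

text \<open>A flow is encoded by the set \<open>T\<close> of leaves \<open>i\<close> with \<open>i \<rightarrow> b\<^sub>e\<close>, \<open>e = {0, i}\<close>, and the
  set \<open>A\<close> of those \<open>i\<close> with \<open>0 \<rightarrow> b\<^sub>e\<close>, which has at most one element and misses \<open>T\<close>.\<close>

lemma card_flows_star:
  "card {\<omega> \<in> orientations (star n). comb_flow (star n) \<omega>} =
     2 ^ n + (\<Sum>T\<in>Pow {1..n}. card ({1..n} - T))"
proof -
  let ?F = "{\<omega> \<in> orientations (star n). comb_flow (star n) \<omega>}"
  let ?C = "Sigma (Pow {1..n}) (\<lambda>T. insert {} ((\<lambda>j. {j}) ` ({1..n} - T)))"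
  define f :: "(nat \<times> nat set \<Rightarrow> int) \<Rightarrow> nat set \<times> nat set"
    where "f \<omega> = ({i\<in>{1..n}. \<omega> (i, {0, i}) = -1}, {i\<in>{1..n}. \<omega> (0, {0, i}) = -1})" for \<omega>
  \<comment> \<open>The inverse encoding: as 0 is not in \<open>T\<close>, the first disjunct
    governs the leaf incidences and the second those of the centre. Restriction makes the result
    extensional, as membership in \<open>orientations\<close> demands.\<close>
  define g :: "nat set \<times> nat set \<Rightarrow> nat \<times> nat set \<Rightarrow> int"
    where "g = (\<lambda>(T, A). restrict
      (\<lambda>(v, e). if v \<in> T \<or> v = 0 \<and> e \<in> (\<lambda>j. {0, j}) ` A then -1 else 1) (incidences (star n)))"
  have g0: "g (T, A) (0, {0, i}) = (if i \<in> A then -1 else 1)"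
    and gi: "g (T, A) (i, {0, i}) = (if i \<in> T then -1 else 1)"
    if "T \<subseteq> {1..n}" "i \<in> {1..n}" for T A i
    using that by (auto simp: g_def incidences_star doubleton_eq_iff image_iff)
  have g0_iff: "g (T, A) (0, {0, i}) = -1 \<longleftrightarrow> i \<in> A"
    and gi_iff: "g (T, A) (i, {0, i}) = -1 \<longleftrightarrow> i \<in> T"
    if "T \<subseteq> {1..n}" "i \<in> {1..n}" for T A i
    using that by (simp_all add: g0 gi)
  have g_orient: "g p \<in> orientations (star n)" for p
    by (auto simp: g_def orientations_def split: prod.splits if_splits)
  have fg: "f (g (T, A)) = (T, A)" if "T \<subseteq> {1..n}" "A \<subseteq> {1..n}" for T A
    using that g0_iff[OF that(1)] gi_iff[OF that(1)] unfolding f_def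
    by (simp only: prod_eq_iff fst_conv snd_conv) blast
  have sub: "T \<subseteq> {1..n} \<and> A \<subseteq> {1..n} \<and> A \<inter> T = {} \<and> (\<exists>\<^sub>\<le>\<^sub>1 i. i \<in> A)" if "(T, A) \<in> ?C" for T A
    using that by (auto simp: Uniq_def)
  have "bij_betw f ?F ?C"
  proof (rule bij_betw_byWitness[where f' = g])
    show "\<forall>\<omega>\<in>?F. g (f \<omega>) = \<omega>"
    proof
      fix \<omega> assume "\<omega> \<in> ?F"
      then have \<omega>: "\<omega> \<in> orientations (star n)"
        by simp
      have "g (f \<omega>) p = \<omega> p" if p: "p \<in> incidences (star n)" for p
      proof -
        have "\<omega> p \<in> {-1, 1}"
          using \<omega> p by (auto simp: orientations_def PiE_iff)
        moreover obtain i where "i \<in> {1..n}" "p = (0, {0, i}) \<or> p = (i, {0, i})"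
          using p unfolding incidences_star by blast
        ultimately show ?thesis
          unfolding f_def by (elim disjE) (simp_all only: g0 gi Collect_restrict, auto)
      qed
      then show "g (f \<omega>) = \<omega>"
        using \<omega> g_orient[of "f \<omega>"] unfolding orientations_def by (intro PiE_ext) auto
    qed
    show "\<forall>p\<in>?C. f (g p) = p"
      using fg sub by auto
    show "f ` ?F \<subseteq> ?C"
    proof
      fix p assume "p \<in> f ` ?F"
      then obtain \<omega> where \<omega>: "\<omega> \<in> ?F" "p = f \<omega>"
        by blast
      define A where "A = {i\<in>{1..n}. \<omega> (0, {0, i}) = -1}"
      have *: "(\<exists>\<^sub>\<le>\<^sub>1 i. i \<in> A)" "\<forall>i\<in>A. \<omega> (i, {0, i}) \<noteq> -1" "A \<subseteq> {1..n}"
        using \<omega>(1) comb_flow_star_iff[of \<omega> n] by (auto simp: A_def)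
      \<comment> \<open>The condition at the centre leaves exactly the two shapes of
        \<open>A\<close> listed in \<open>?C\<close>.\<close>
      have "A = {} \<or> (\<exists>j\<in>A. A = {j})"
        using *(1) unfolding Uniq_def by blast
      then show "p \<in> ?C"
        using * unfolding \<omega>(2) f_def A_def[symmetric] by auto
    qed
    show "g ` ?C \<subseteq> ?F"
    proof
      fix \<omega> assume "\<omega> \<in> g ` ?C"
      then obtain T A where TA: "(T, A) \<in> ?C" and \<omega>: "\<omega> = g (T, A)"
        by blast
      note s = sub[OF TA]
      have "(i \<in> {1..n} \<and> g (T, A) (0, {0, i}) = -1) \<longleftrightarrow> i \<in> A" for i
        using s g0_iff[of T i A] by blast
      moreover have "\<forall>i\<in>{1..n}. g (T, A) (0, {0, i}) = -1 \<longrightarrow> g (T, A) (i, {0, i}) \<noteq> -1"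
        using s g0_iff[of T _ A] gi_iff[of T _ A] by blast
      ultimately have "comb_flow (star n) (g (T, A))"
        using s by (simp only: comb_flow_star_iff[OF g_orient])
      then show "\<omega> \<in> ?F"
        using g_orient \<omega> by simp
    qed
  qed
  then have "card ?F = card ?C"
    by (rule bij_betw_same_card)
  also have "\<dots> = (\<Sum>T\<in>Pow {1..n}. card (insert {} ((\<lambda>j. {j}) ` ({1..n} - T))))"
    by (subst card_SigmaI) auto
  \<comment> \<open>The summand 1 counts the empty \<open>A\<close>; the rest counts the
    singletons.\<close>
  also have "\<dots> = (\<Sum>T\<in>Pow {1..n}. 1 + card ({1..n} - T))"
    by (rule sum.cong) (auto simp: card_insert_if card_image)
  finally show ?thesis
    by (simp only: sum.distrib) (simp add: card_Pow)
qed

lemma flow_prob_star: "flow_prob (star n) = (real n + 2) / 2 ^ (n + 1)"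
proof -
  have "2 * card {\<omega> \<in> orientations (star n). comb_flow (star n) \<omega>} = (n + 2) * 2 ^ n"
    using sum_card_Diff_Pow[of "{1..n}"] by (simp add: card_flows_star algebra_simps)
  from arg_cong[OF this, of real]
  have "2 * real (card {\<omega> \<in> orientations (star n). comb_flow (star n) \<omega>}) = (real n + 2) * 2 ^ n"
    by (simp add: distrib_right)
  moreover have "(4::real) ^ n = 2 ^ n * 2 ^ n"
    using power_mult_distrib[of "2::real" 2 n] by simp
  ultimately show ?thesis
    by (simp add: flow_prob_eq[OF simple_graph_star] num_edges_star field_simps)
qed

section \<open>Asymptotics of the entropy\<close>

lemma flow_entropy_star:
  "n > 0 \<Longrightarrow> flow_entropy (star n) = ln ((real n + 2) / 2 ^ (n + 1)) / real n"
  by (simp add: flow_entropy_def flow_prob_star num_edges_star) (simp add: star_def)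

text \<open>The logarithm is ln(n+2) - (n+1) ln 2, and ln(n+2)/n tends to 0. As the limit is
  nonzero, convergence amounts to asymptotic equivalence.\<close>

lemma flow_entropy_star_tendsto: "(\<lambda>n. flow_entropy (star n)) \<longlonglongrightarrow> ln (1 / 2)"
proof -
  have "(\<lambda>n. ln ((real n + 2) / 2 ^ (n + 1)) / real n) \<longlonglongrightarrow> ln (1 / 2)"
    by (real_asymp simp: ln_div)
  then show ?thesis
    by (rule Lim_transform_eventually)
       (auto simp: flow_entropy_star intro: eventually_mono[OF eventually_gt_at_top[of 0]])
qed

theorem theorem3p1:
  shows "(\<forall>n\<ge>1.
            trunc (graph_poly (star n)) =
              Const (1 / 4 ^ n) * (\<Sum>S\<in>Pow {1..n}. \<Prod>i\<in>S. Var i)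
            + Const (1 / 4 ^ n) *
                (\<Sum>S\<in>Pow {1..n}. Const (real n - real (card S)) * Var 0 * (\<Prod>i\<in>S. Var i))
          \<and> flow_prob (star n) = (real n + 2) / 2 ^ (n + 1))
       \<and> (\<lambda>n. flow_entropy (star n)) \<sim>[at_top] (\<lambda>_. ln (1 / 2))"
  by (intro conjI allI impI trunc_graph_poly_star flow_prob_star
      tendsto_imp_asymp_equiv_const[OF flow_entropy_star_tendsto]) simp

end
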